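(* Let $\varphi\in L^2(\mathbb{T})$ be a symbol such that all the Fourier coefficients of $R_-(\varphi)$ are positive, i.e. $\widehat\varphi(m)\ge0$ for all integers $m\le0$. Then a necessary and sufficient condition for $H_\varphi\in B(H^2,L^\infty)$ is $$\sum_{n=0}^\infty\Big(\sum_{m=-\infty}^{-n}\widehat\varphi(m)\Big)^2<\infty .$$
   Context: $\mathbb{T}=\mathbb{R}/2\pi\mathbb{Z}$ with normalized Haar measure $m$; $\widehat\varphi(n)=\int_{\mathbb{T}}\varphi(e^{i\theta})e^{-in\theta}dm(\theta)$. $H^2(\mathbb{T})$ is the set of $f(e^{i\theta})=\sum_{n\ge0}a_ne^{in\theta}$ with $\|f\|_{H^2}^2=\sum|a_n|^2<\infty$. $R_-$ is the orthogonal projection of $L^2(\mathbb{T})$ onto the closed span of $\{e^{in\theta}:n\le0\}$. The Hankel operator with symbol $\varphi\in L^2(\mathbb{T})$ is defined on analytic trigonometric polynomials $f=\sum_{n\ge0}a_ne^{in\theta}$ by $$H_\varphi(f)=R_-(\varphi f)=\sum_{k=-\infty}^0\Big(\sum_{n=-\infty}^k\widehat\varphi(n)a_{k-n}\Big)e^{ik\theta}.$$ $H_\varphi\in B(H^2,L^\infty)$ means that $H_\varphi$ defines (extends to) a bounded operator from $H^2(\mathbb{T})$ to $L^\infty(\mathbb{T})$. *)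

theory Defs
  imports "HOL-Probability.Probability"
begin

text \<open>
  The circle is realised as the unit circle of the complex plane: a function on it is a function
  \<^typ>\<open>complex \<Rightarrow> complex\<close>, whose values off the circle are irrelevant, and \<open>e\<^sup>i\<^sup>n\<^sup>\<theta>\<close> is \<open>z powi n\<close>.
  Elements of \<open>L\<^sup>2\<close>, \<open>H\<^sup>2\<close> and \<open>L\<^sup>\<infinity>\<close> are represented by functions; equality in these spaces is
  equality almost everywhere.
\<close>

definition circle :: "complex measure" where
  "circle = distr (uniform_measure lborel {0..<2 * pi}) (restrict_space borel (sphere 0 1)) cis"

definition L2 :: "(complex \<Rightarrow> complex) set" where
  "L2 = {f \<in> borel_measurable circle. integrable circle (\<lambda>z. (cmod (f z))\<^sup>2)}"

definition L2_inner :: "(complex \<Rightarrow> complex) \<Rightarrow> (complex \<Rightarrow> complex) \<Rightarrow> complex" where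
  "L2_inner f g = (LINT z|circle. f z * cnj (g z))"

definition L2_norm :: "(complex \<Rightarrow> complex) \<Rightarrow> real" where
  "L2_norm f = sqrt (LINT z|circle. (cmod (f z))\<^sup>2)"

definition fourier :: "(complex \<Rightarrow> complex) \<Rightarrow> int \<Rightarrow> complex" where
  "fourier f n = (LINT z|circle. f z * z powi (- n))"

definition trig_span :: "int set \<Rightarrow> (complex \<Rightarrow> complex) set" where
  "trig_span S = {(\<lambda>z. \<Sum>n\<in>F. c n * z powi n) | F c. finite F \<and> F \<subseteq> S}"

definition closed_trig_span :: "int set \<Rightarrow> (complex \<Rightarrow> complex) set" where
  "closed_trig_span S = {f \<in> L2. \<forall>\<epsilon>>0. \<exists>p\<in>trig_span S. L2_norm (\<lambda>z. f z - p z) < \<epsilon>}"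

text \<open>\<open>R_minus g h\<close>: the function \<open>h\<close> represents \<open>R\<^sub>-(g)\<close>, the orthogonal projection of \<open>g\<close>.\<close>

definition R_minus :: "(complex \<Rightarrow> complex) \<Rightarrow> (complex \<Rightarrow> complex) \<Rightarrow> bool" where
  "R_minus g h \<longleftrightarrow> g \<in> L2 \<and> h \<in> closed_trig_span {..0} \<and>
     (\<forall>u\<in>closed_trig_span {..0}. L2_inner (\<lambda>z. g z - h z) u = 0)"

definition H2 :: "(complex \<Rightarrow> complex) set" where
  "H2 = {f \<in> L2. \<exists>a :: nat \<Rightarrow> complex. summable (\<lambda>n. (cmod (a n))\<^sup>2) \<and>
     (\<lambda>N. L2_norm (\<lambda>z. f z - (\<Sum>n<N. a n * z ^ n))) \<longlonglongrightarrow> 0}"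

text \<open>The coefficients \<open>a\<close> in the expansion of \<open>f \<in> H2\<close> are its Fourier coefficients.\<close>

definition H2_norm :: "(complex \<Rightarrow> complex) \<Rightarrow> real" where
  "H2_norm f = sqrt (\<Sum>n. (cmod (fourier f (int n)))\<^sup>2)"

definition Linf_norm :: "(complex \<Rightarrow> complex) \<Rightarrow> ereal" where
  "Linf_norm f = esssup circle (\<lambda>z. ereal (cmod (f z)))"

definition Linf :: "(complex \<Rightarrow> complex) set" where
  "Linf = {f \<in> borel_measurable circle. Linf_norm f < \<infinity>}"

definition bounded_operator_H2_Linf ::
  "((complex \<Rightarrow> complex) \<Rightarrow> (complex \<Rightarrow> complex)) \<Rightarrow> bool" where
  "bounded_operator_H2_Linf T \<longleftrightarrow>
     (\<forall>f\<in>H2. T f \<in> Linf) \<and>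
     (\<forall>f\<in>H2. \<forall>g\<in>H2. (AE z in circle. f z = g z) \<longrightarrow> (AE z in circle. T f z = T g z)) \<and>
     (\<forall>f\<in>H2. \<forall>g\<in>H2. AE z in circle. T (\<lambda>w. f w + g w) z = T f z + T g z) \<and>
     (\<forall>c. \<forall>f\<in>H2. AE z in circle. T (\<lambda>w. c * f w) z = c * T f z) \<and>
     (\<exists>C :: real. \<forall>f\<in>H2. Linf_norm (T f) \<le> ereal (C * H2_norm f))"

text \<open>
  \<open>H\<^sub>\<phi> \<in> B(H\<^sup>2, L\<^sup>\<infinity>)\<close>: some bounded operator from \<open>H\<^sup>2\<close> to \<open>L\<^sup>\<infinity>\<close> agrees with
  \<open>f \<mapsto> R\<^sub>-(\<phi> f)\<close> on the analytic trigonometric polynomials.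
\<close>

definition hankel_bounded_H2_Linf :: "(complex \<Rightarrow> complex) \<Rightarrow> bool" where
  "hankel_bounded_H2_Linf \<phi> \<longleftrightarrow>
     (\<exists>T. bounded_operator_H2_Linf T \<and>
          (\<forall>f\<in>trig_span {0..}. R_minus (\<lambda>z. \<phi> z * f z) (T f)))"

end

theory Submission
  imports Defs
begin

text \<open>
  Write \<open>b k\<close> for the Fourier coefficient of the symbol \<open>\<phi>\<close> at \<open>-k\<close> and \<open>tail b n = \<Sum>\<^bsub>k\<^esub> b (n + k)\<close> for the
  inner sums of the criterion. In the bases of characters the Hankel operator has the matrix
  \<open>b (n + k)\<close>: the monomial \<open>z\<^sup>n\<close> goes to \<open>\<Sum>\<^bsub>k\<^esub> b (n + k) z\<^sup>-\<^sup>k\<close>. As the entries are nonnegative, the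
  supremum of this function is its value \<open>tail b n\<close> at \<open>z = 1\<close>. More generally, on
  functions with nonnegative coefficients the supremum of the image is its value at \<open>1\<close>,
  which is the linear functional \<open>a \<mapsto> \<Sum>\<^bsub>n\<^esub> a n tail b n\<close> of the coefficient sequence \<open>a\<close>. That functional is
  bounded on \<open>\<ell>\<^sup>2\<close> precisely when the tails are square-summable.

  Sufficiency. The operator is extended to \<open>H\<^sup>2\<close> by the series \<open>\<Sum>\<^bsub>n\<^esub> fourier f n \<cdot> monomial_image b n z\<close>,
  which Cauchy--Schwarz and Bessel's inequality bound at each point of the circle
  (\<open>norm_hankel_series_le\<close>). That it represents \<open>R\<^sub>-(\<phi> f)\<close> for a polynomial \<open>f\<close> follows from the
  fact that an absolutely convergent Fourier series represents the projection (\<open>R_minus_of_summable\<close>).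

  Necessity. An element of \<open>L\<^sup>\<infinity>\<close> has no value at \<open>1\<close>; its place is taken by a mean against the
  Fejer kernel, which shows that a function bounded by \<open>B\<close> with nonnegative coefficients, all at
  frequencies \<open>\<le> 0\<close>, has coefficient sum at most \<open>B\<close> (\<open>nonneg_fourier_sum_le_bound\<close>). Applied to the
  image of a polynomial whose coefficients are truncated tails, this bounds the sum of the squares of
  those tails by the square of the operator bound (\<open>hankel_bounded_imp_tail_summable\<close>).
\<close>

section \<open>Integration on the circle\<close>

lemma space_circle [simp]: "space circle = sphere 0 1"
  by (simp add: circle_def space_restrict_space)

lemma sets_circle: "sets circle = sets (restrict_space borel (sphere 0 1))"
  by (simp add: circle_def)

lemma measurable_cis_circle:
  "cis \<in> uniform_measure lborel {0..<2 * pi} \<rightarrow>\<^sub>M restrict_space borel (sphere 0 1)"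
proof (rule measurable_restrict_space2)
  have "cis \<in> borel_measurable (lborel :: real measure)"
    by (auto intro!: borel_measurable_continuous_onI continuous_on_cis)
  then show "cis \<in> borel_measurable (uniform_measure lborel {0..<2 * pi})"
    by (subst measurable_cong_sets[OF sets_uniform_measure refl])
qed auto

interpretation circle: prob_space circle
  unfolding circle_def
  by (intro prob_space.prob_space_distr prob_space_uniform_measure measurable_cis_circle) auto

lemma borel_measurable_circleI:
  fixes f :: "complex \<Rightarrow> 'b::topological_space"
  assumes "continuous_on (sphere 0 1) f"
  shows "f \<in> borel_measurable circle"
  using borel_measurable_continuous_on_restrict[OF assms]
  by (subst measurable_cong_sets[OF sets_circle refl])

lemma continuous_on_sphere_powi: "continuous_on (sphere 0 1) (\<lambda>z::complex. z powi n)"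
  by (rule continuous_intros) (auto intro: continuous_intros)

lemma measurable_powi [measurable]: "(\<lambda>z. z powi n) \<in> borel_measurable circle"
  by (rule borel_measurable_circleI[OF continuous_on_sphere_powi])

lemma norm_powi_circle: "norm z = 1 \<Longrightarrow> norm (z powi n) = 1" for z :: complex
  by (simp add: norm_power_int)

lemma cnj_powi_circle: "cnj z powi n = z powi (- n)" if "norm z = 1" for z :: complex
proof -
  have "z \<noteq> 0" using that by (metis norm_zero zero_neq_one)
  have "z powi n * cnj (z powi n) = 1"
    unfolding complex_norm_square[symmetric] norm_powi_circle[OF that] by simp
  moreover have "z powi n * z powi (- n) = 1"
    using power_int_add[of z n "- n"] \<open>z \<noteq> 0\<close> by simp
  moreover have "z powi n \<noteq> 0" using \<open>z \<noteq> 0\<close> by simp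
  ultimately have "cnj (z powi n) = z powi (- n)" by (metis mult_left_cancel)
  then show ?thesis by simp
qed

text \<open>
For \<open>n \<noteq> 0\<close> the substitution \<open>z = e\<^sup>i\<^sup>t\<close> turns this into the integral of \<open>e\<^sup>i\<^sup>n\<^sup>t\<close> over a full period, whose primitive
\<open>e\<^sup>i\<^sup>n\<^sup>t / (i n)\<close> is itself periodic. This is the orthonormality of the characters, on which every
later computation with Fourier coefficients rests.
\<close>
lemma integral_powi_circle: "(LINT z|circle. z powi n) = of_bool (n = 0)"
proof (cases "n = 0")
  case True
  then show ?thesis by (simp add: circle.prob_space[simplified])
next
  case False
  define F where "F t = cis (of_int n * t) / (\<i> * of_int n)" for t
  have der: "(F has_vector_derivative cis (of_int n * t)) (at t within A)" for t A
    unfolding F_def using False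
    by (auto intro!: derivative_eq_intros simp: has_vector_derivative_def fun_eq_iff scaleR_conv_of_real)
      (simp add: complex_eq_iff)
  have cis_meas [measurable]: "(\<lambda>t. cis (of_int n * t)) \<in> borel_measurable borel"
    by (intro borel_measurable_continuous_onI continuous_intros)
  have density_eq: "uniform_measure lborel {0..<2 * pi} =
      density lborel (\<lambda>t. ennreal (indicator {0..<2 * pi} t / (2 * pi)))"
    unfolding uniform_measure_def
    by (intro density_cong) (auto simp: indicator_def divide_ennreal simp flip: ennreal_1)
  have "(LINT z|circle. z powi n) = (LINT t|uniform_measure lborel {0..<2 * pi}. cis t powi n)"
    unfolding circle_def
    by (rule integral_distr[OF measurable_cis_circle])
       (use measurable_powi[of n] in \<open>simp add: measurable_cong_sets[OF sets_circle refl]\<close>)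
  also have "\<dots> = (LINT t|lborel. indicator {0..2*pi} t *\<^sub>R (cis (of_int n * t) /\<^sub>R (2*pi)))"
    unfolding density_eq
  proof (subst integral_density)
    show "(LINT t|lborel. (indicator {0..<2*pi} t / (2*pi)) *\<^sub>R (cis t powi n)) =
      (LINT t|lborel. indicator {0..2*pi} t *\<^sub>R (cis (of_int n * t) /\<^sub>R (2*pi)))"
    proof (rule integral_cong_AE)
      show "AE t in lborel. (indicator {0..<2*pi} t / (2*pi)) *\<^sub>R (cis t powi n) =
        indicator {0..2*pi} t *\<^sub>R (cis (of_int n * t) /\<^sub>R (2*pi))"
        \<comment> \<open>The half-open interval of the parametrisation and the closed one of the fundamental theorem differ at one point.\<close>
        using AE_lborel_singleton[of "2*pi"]
        by eventually_elim (auto simp: cis_power_int indicator_def field_simps)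
    qed (use cis_meas in \<open>simp_all add: cis_power_int\<close>)
  qed (use cis_meas in \<open>simp_all add: cis_power_int\<close>)
  also have "\<dots> = F (2*pi) /\<^sub>R (2*pi) - F 0 /\<^sub>R (2*pi)"
    by (rule integral_FTC_atLeastAtMost)
      (auto intro!: continuous_intros bounded_linear.has_vector_derivative[OF bounded_linear_scaleR_right] der)
  also have "\<dots> = 0"
    using cis_multiple_2pi[of "of_int n"] by (simp add: F_def ac_simps)
  finally show ?thesis using False by simp
qed

lemma AE_circleI: "(\<And>z. norm z = 1 \<Longrightarrow> P z) \<Longrightarrow> AE z in circle. P z"
  by (rule AE_I2) simp

lemma integral_circle_cong:
  "(\<And>z. norm z = 1 \<Longrightarrow> f z = g z) \<Longrightarrow> (LINT z|circle. f z) = (LINT z|circle. g z)"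
  by (rule Bochner_Integration.integral_cong) auto

section \<open>The space of square-integrable functions\<close>

lemma L2_measurable: "f \<in> L2 \<Longrightarrow> f \<in> borel_measurable circle"
  by (simp add: L2_def)

text \<open>
The measure has total mass one, so uniform approximation on the circle is also approximation in
\<open>L\<^sup>2\<close>, with the same error.
\<close>
lemma L2_bounded:
  assumes f: "f \<in> borel_measurable circle" and B: "\<And>z. norm z = 1 \<Longrightarrow> cmod (f z) \<le> B"
  shows "f \<in> L2" "L2_norm f \<le> B"
proof -
  have "cmod (f 1) \<le> B" by (rule B) simp
  hence B0: "0 \<le> B" by (rule order_trans[OF norm_ge_zero])
  have le: "(cmod (f z))\<^sup>2 \<le> B\<^sup>2" if "norm z = 1" for z
    using B[OF that] by (rule power_mono) simp
  have int: "integrable circle (\<lambda>z. (cmod (f z))\<^sup>2)"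
    by (rule circle.integrable_const_bound[of _ "B\<^sup>2"]) (use f le in \<open>auto intro: AE_circleI\<close>)
  then show "f \<in> L2" using f by (simp add: L2_def)
  have "(LINT z|circle. (cmod (f z))\<^sup>2) \<le> (LINT z|circle. B\<^sup>2)"
    using int le by (intro integral_mono) auto
  also have "\<dots> = B\<^sup>2" by (simp add: circle.prob_space[simplified])
  finally show "L2_norm f \<le> B"
    unfolding L2_norm_def using B0 by (simp add: real_le_lsqrt)
qed

lemma L2_mult_bounded:
  assumes f: "f \<in> L2" and g: "g \<in> borel_measurable circle"
    and B: "\<And>z. norm z = 1 \<Longrightarrow> cmod (g z) \<le> B"
  shows "(\<lambda>z. f z * g z) \<in> L2"
proof -
  have le: "(cmod (f z * g z))\<^sup>2 \<le> B\<^sup>2 * (cmod (f z))\<^sup>2" if "norm z = 1" for z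
    unfolding norm_mult power_mult_distrib mult.commute[of "(cmod (f z))\<^sup>2"]
    by (intro mult_right_mono power_mono B that) auto
  have "integrable circle (\<lambda>z. (cmod (f z * g z))\<^sup>2)"
  proof (rule Bochner_Integration.integrable_bound)
    show "integrable circle (\<lambda>z. B\<^sup>2 * (cmod (f z))\<^sup>2)"
      using f by (simp add: L2_def)
    show "(\<lambda>z. (cmod (f z * g z))\<^sup>2) \<in> borel_measurable circle"
      using L2_measurable[OF f] g by measurable
    show "AE z in circle. norm ((cmod (f z * g z))\<^sup>2) \<le> norm (B\<^sup>2 * (cmod (f z))\<^sup>2)"
      using le by (intro AE_circleI) simp
  qed
  then show ?thesis using L2_measurable[OF f] g by (simp add: L2_def)
qed

lemma L2_add:
  assumes f: "f \<in> L2" and g: "g \<in> L2"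
  shows "(\<lambda>z. f z + g z) \<in> L2"
proof -
  have le: "(cmod (f z + g z))\<^sup>2 \<le> 2 * (cmod (f z))\<^sup>2 + 2 * (cmod (g z))\<^sup>2" for z
  proof -
    have "(cmod (f z + g z))\<^sup>2 \<le> (cmod (f z) + cmod (g z))\<^sup>2"
      by (intro power_mono norm_triangle_ineq norm_ge_zero)
    also have "\<dots> \<le> 2 * (cmod (f z))\<^sup>2 + 2 * (cmod (g z))\<^sup>2"
      using sum_squares_bound[of "cmod (f z)" "cmod (g z)"] by (simp add: power2_sum)
    finally show ?thesis .
  qed
  have "integrable circle (\<lambda>z. (cmod (f z + g z))\<^sup>2)"
  proof (rule Bochner_Integration.integrable_bound)
    show "integrable circle (\<lambda>z. 2 * (cmod (f z))\<^sup>2 + 2 * (cmod (g z))\<^sup>2)"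
      using f g by (simp add: L2_def)
    show "(\<lambda>z. (cmod (f z + g z))\<^sup>2) \<in> borel_measurable circle"
      using L2_measurable[OF f] L2_measurable[OF g] by measurable
    show "AE z in circle. norm ((cmod (f z + g z))\<^sup>2) \<le> norm (2 * (cmod (f z))\<^sup>2 + 2 * (cmod (g z))\<^sup>2)"
      using le by simp
  qed
  then show ?thesis using L2_measurable[OF f] L2_measurable[OF g] by (simp add: L2_def)
qed

lemma L2_cmult: "f \<in> L2 \<Longrightarrow> (\<lambda>z. c * f z) \<in> L2"
  using L2_mult_bounded[of f "\<lambda>_. c" "cmod c"] by (simp add: mult.commute[of c])

lemma L2_diff: "f \<in> L2 \<Longrightarrow> g \<in> L2 \<Longrightarrow> (\<lambda>z. f z - g z) \<in> L2"
  using L2_add[OF _ L2_cmult[of g "-1"], of f] by simp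

lemma L2_sum: "(\<And>i. i \<in> I \<Longrightarrow> f i \<in> L2) \<Longrightarrow> (\<lambda>z. \<Sum>i\<in>I. f i z) \<in> L2"
proof (induction I rule: infinite_finite_induct)
  case (insert i I)
  then show ?case using L2_add[of "f i" "\<lambda>z. \<Sum>i\<in>I. f i z"] by simp
qed (auto intro: L2_bounded(1)[of _ 0])

lemma L2_powi: "(\<lambda>z. z powi n) \<in> L2"
  by (rule L2_bounded(1)[of _ 1]) (auto simp: norm_powi_circle)

lemma integrable_L2_inner:
  assumes f: "f \<in> L2" and g: "g \<in> L2"
  shows "integrable circle (\<lambda>z. f z * cnj (g z))"
proof (rule Bochner_Integration.integrable_bound)
  show "integrable circle (\<lambda>z. (cmod (f z))\<^sup>2 + (cmod (g z))\<^sup>2)"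
    using f g by (simp add: L2_def)
  show "(\<lambda>z. f z * cnj (g z)) \<in> borel_measurable circle"
    using L2_measurable[OF f] borel_measurable_continuous_on[OF continuous_on_cnj[OF continuous_on_id] L2_measurable[OF g]]
    by measurable
  have "cmod (f z) * cmod (g z) \<le> (cmod (f z))\<^sup>2 + (cmod (g z))\<^sup>2" for z
    using sum_squares_bound[of "cmod (f z)" "cmod (g z)"] mult_nonneg_nonneg[OF norm_ge_zero norm_ge_zero, of "f z" "g z"]
    unfolding mult.assoc by linarith
  then show "AE z in circle. norm (f z * cnj (g z)) \<le> norm ((cmod (f z))\<^sup>2 + (cmod (g z))\<^sup>2)"
    by (simp add: norm_mult)
qed

lemma L2_norm_nonneg: "0 \<le> L2_norm f"
  by (simp add: L2_norm_def)

lemma L2_norm_nn_integral: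
  assumes "f \<in> L2"
  shows "(\<integral>\<^sup>+z. ennreal (cmod (f z)) ^ 2 \<partial>circle) = ennreal ((L2_norm f)\<^sup>2)"
  using assms by (simp add: L2_def L2_norm_def ennreal_power nn_integral_eq_integral)

lemma L2_inner_Cauchy_Schwarz:
  assumes f: "f \<in> L2" and g: "g \<in> L2"
  shows "cmod (L2_inner f g) \<le> L2_norm f * L2_norm g"
proof -
  have "ennreal (cmod (L2_inner f g)) \<le> (\<integral>\<^sup>+z. cmod (f z * cnj (g z)) \<partial>circle)"
    unfolding L2_inner_def using integrable_L2_inner[OF f g]
    by (intro integral_norm_bound_ennreal)
  then have "ennreal (cmod (L2_inner f g)) ^ 2 \<le> (\<integral>\<^sup>+z. ennreal (cmod (f z)) * ennreal (cmod (g z)) \<partial>circle) ^ 2"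
    by (intro power_mono) (auto simp: norm_mult ennreal_mult)
  also have "\<dots> \<le> ennreal ((L2_norm f)\<^sup>2) * ennreal ((L2_norm g)\<^sup>2)"
    using Cauchy_Schwarz_nn_integral[of "\<lambda>z. ennreal (cmod (f z))" circle "\<lambda>z. ennreal (cmod (g z))"]
      L2_measurable[OF f] L2_measurable[OF g] by (simp add: L2_norm_nn_integral f g)
  also have "\<dots> = ennreal ((L2_norm f * L2_norm g)\<^sup>2)"
    by (simp add: ennreal_mult power_mult_distrib)
  finally have "(cmod (L2_inner f g))\<^sup>2 \<le> (L2_norm f * L2_norm g)\<^sup>2"
    by (simp add: ennreal_power)
  then show ?thesis
    by (rule power2_le_imp_le) (simp add: L2_norm_nonneg)
qed

section \<open>Fourier coefficients\<close>

lemma fourier_eq_inner: "fourier f n = L2_inner f (\<lambda>z. z powi n)"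
  unfolding fourier_def L2_inner_def by (rule integral_circle_cong) (simp add: cnj_powi_circle)

lemma integrable_fourier: "f \<in> L2 \<Longrightarrow> integrable circle (\<lambda>z. f z * z powi n)"
  using integrable_L2_inner[OF _ L2_powi, of f "-n"]
  by (subst Bochner_Integration.integrable_cong[OF refl, of _ _ "\<lambda>z. f z * cnj (z powi (-n))"])
     (auto simp: cnj_powi_circle)

lemma fourier_add: "f \<in> L2 \<Longrightarrow> g \<in> L2 \<Longrightarrow> fourier (\<lambda>z. f z + g z) n = fourier f n + fourier g n"
  by (simp add: fourier_def distrib_right integrable_fourier)

lemma fourier_diff: "f \<in> L2 \<Longrightarrow> g \<in> L2 \<Longrightarrow> fourier (\<lambda>z. f z - g z) n = fourier f n - fourier g n"
  by (simp add: fourier_def left_diff_distrib integrable_fourier)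

lemma fourier_cmult: "fourier (\<lambda>z. c * f z) n = c * fourier f n"
  by (simp add: fourier_def mult.assoc)

lemma fourier_cong_AE:
  assumes "f \<in> L2" "g \<in> L2" "AE z in circle. f z = g z"
  shows "fourier f n = fourier g n"
  unfolding fourier_def using assms by (intro integral_cong_AE) (auto dest: L2_measurable)

lemma L2_norm_powi: "L2_norm (\<lambda>z. z powi n) \<le> 1"
  by (rule L2_bounded(2)) (auto simp: norm_powi_circle)

text \<open>
Continuity of Fourier coefficients in \<open>L\<^sup>2\<close>: this is what carries information about trigonometric
polynomials over to the closure of their span.
\<close>
lemma norm_fourier_le: "f \<in> L2 \<Longrightarrow> cmod (fourier f n) \<le> L2_norm f"
  using L2_inner_Cauchy_Schwarz[OF _ L2_powi, of f n]
    mult_left_mono[OF L2_norm_powi L2_norm_nonneg, of f n]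
  by (simp add: fourier_eq_inner)

lemma fourier_mult_powi: "fourier (\<lambda>z. f z * z powi m) n = fourier f (n - m)"
  unfolding fourier_def
proof (rule integral_circle_cong)
  fix z :: complex assume "norm z = 1"
  then have "z \<noteq> 0" by auto
  then show "f z * z powi m * z powi - n = f z * z powi - (n - m)"
    by (simp add: power_int_diff power_int_minus field_simps)
qed

lemma fourier_sum:
  assumes "\<And>i. i \<in> I \<Longrightarrow> f i \<in> L2"
  shows "fourier (\<lambda>z. \<Sum>i\<in>I. f i z) n = (\<Sum>i\<in>I. fourier (f i) n)"
  using assms by (simp add: fourier_def sum_distrib_right integrable_fourier)

lemma L2_trig: "(\<lambda>z. \<Sum>n\<in>F. c n * z powi n) \<in> L2"
  by (intro L2_sum L2_cmult L2_powi)

lemma fourier_powi: "fourier (\<lambda>z. z powi m) n = of_bool (n = m)"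
  using fourier_mult_powi[of "\<lambda>_. 1" m n] integral_powi_circle[of "m - n"]
  by (auto simp: fourier_def)

lemma fourier_trig:
  assumes "finite F"
  shows "fourier (\<lambda>z. \<Sum>n\<in>F. c n * z powi n) m = (if m \<in> F then c m else 0)"
  using assms by (simp add: fourier_sum L2_cmult L2_powi fourier_cmult fourier_powi of_bool_def if_distrib sum.delta' cong: if_cong)

lemma trig_span_L2: "p \<in> trig_span S \<Longrightarrow> p \<in> L2"
  by (auto simp: trig_span_def L2_trig)

lemma inner_trig:
  assumes "f \<in> L2"
  shows "L2_inner f (\<lambda>z. \<Sum>n\<in>F. c n * z powi n) = (\<Sum>n\<in>F. fourier f n * cnj (c n))"
proof -
  have "L2_inner f (\<lambda>z. \<Sum>n\<in>F. c n * z powi n) = (LINT z|circle. (\<Sum>n\<in>F. cnj (c n) * (f z * z powi (- n))))"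
    unfolding L2_inner_def
    by (rule integral_circle_cong) (simp add: sum_distrib_left cnj_powi_circle ac_simps)
  also have "\<dots> = (\<Sum>n\<in>F. fourier f n * cnj (c n))"
    using assms by (simp add: integrable_fourier fourier_def mult.commute)
  finally show ?thesis .
qed

lemma L2_norm_sq: "of_real ((L2_norm f)\<^sup>2) = L2_inner f f"
proof -
  have "L2_inner f f = (LINT z|circle. complex_of_real ((cmod (f z))\<^sup>2))"
    unfolding L2_inner_def complex_norm_square ..
  then show ?thesis by (simp add: L2_norm_def del: of_real_power)
qed

text \<open>
Let \<open>s\<close> be the left-hand side and \<open>p\<close> the partial Fourier sum over \<open>F\<close>. Orthonormality gives
\<open>\<langle>f, p\<rangle> = s = \<parallel>p\<parallel>\<^sup>2\<close>, so Cauchy--Schwarz reads \<open>s \<le> \<parallel>f\<parallel> s\<^sup>1\<^sup>/\<^sup>2\<close>.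
\<close>
lemma Bessel_inequality:
  assumes f: "f \<in> L2" and F: "finite F"
  shows "(\<Sum>n\<in>F. (cmod (fourier f n))\<^sup>2) \<le> (L2_norm f)\<^sup>2"
proof -
  define s where "s = (\<Sum>n\<in>F. (cmod (fourier f n))\<^sup>2)"
  define p where "p = (\<lambda>z. \<Sum>n\<in>F. fourier f n * z powi n)"
  have p: "p \<in> L2" by (simp add: p_def L2_trig)
  have s0: "0 \<le> s" by (simp add: s_def sum_nonneg)
  have fp: "L2_inner f p = of_real s"
    by (simp add: p_def inner_trig[OF f] s_def complex_norm_square del: of_real_power)
  have "L2_inner p p = of_real s"
    by (subst (2) p_def, subst inner_trig[OF p])
       (simp add: p_def fourier_trig[OF F] s_def complex_norm_square del: of_real_power)
  then have "complex_of_real ((L2_norm p)\<^sup>2) = of_real s" by (simp only: L2_norm_sq)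
  then have ps: "(L2_norm p)\<^sup>2 = s" by (simp only: of_real_eq_iff)
  have "s \<le> L2_norm f * L2_norm p"
    using L2_inner_Cauchy_Schwarz[OF f p] s0 by (simp add: fp)
  then have "s\<^sup>2 \<le> (L2_norm f)\<^sup>2 * s"
    using power_mono[OF _ s0, of "L2_norm f * L2_norm p" 2] by (simp add: power_mult_distrib ps)
  then have "s \<le> (L2_norm f)\<^sup>2"
    using s0 by (cases "s = 0") (auto simp: power2_eq_square)
  then show ?thesis by (simp only: s_def)
qed

lemma H2_L2: "f \<in> H2 \<Longrightarrow> f \<in> L2" by (simp add: H2_def)

lemma summable_fourier_sq:
  assumes "f \<in> L2"
  shows "summable (\<lambda>n. (cmod (fourier f (int n)))\<^sup>2)"
proof (rule summableI_nonneg_bounded)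
  fix N
  have "(\<Sum>n<N. (cmod (fourier f (int n)))\<^sup>2) = (\<Sum>n\<in>int ` {..<N}. (cmod (fourier f n))\<^sup>2)"
    by (simp add: sum.reindex)
  then show "(\<Sum>n<N. (cmod (fourier f (int n)))\<^sup>2) \<le> (L2_norm f)\<^sup>2"
    using Bessel_inequality[OF assms, of "int ` {..<N}"] by simp
qed simp

lemma fourier_approx:
  assumes f: "f \<in> L2" and p: "\<And>e. e > 0 \<Longrightarrow> \<exists>p\<in>L2. L2_norm (\<lambda>z. f z - p z) < e \<and> fourier p n = a"
  shows "fourier f n = a"
proof (rule ccontr)
  assume "fourier f n \<noteq> a"
  then have "0 < cmod (fourier f n - a)" by simp
  from p[OF this] obtain p where p: "p \<in> L2" "L2_norm (\<lambda>z. f z - p z) < cmod (fourier f n - a)" "fourier p n = a"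
    by blast
  then show False
    using norm_fourier_le[OF L2_diff[OF f p(1)], of n] by (simp add: fourier_diff f)
qed

lemma fourier_closed_trig_span:
  assumes f: "f \<in> closed_trig_span S" and n: "n \<notin> S"
  shows "fourier f n = 0"
proof (rule fourier_approx)
  fix e :: real assume "e > 0"
  then obtain p where p: "p \<in> trig_span S" "L2_norm (\<lambda>z. f z - p z) < e"
    using f by (auto simp: closed_trig_span_def)
  then have "fourier p n = 0"
    using n by (auto simp: trig_span_def fourier_trig)
  then show "\<exists>p\<in>L2. L2_norm (\<lambda>z. f z - p z) < e \<and> fourier p n = 0"
    using p trig_span_L2 by blast
qed (use f in \<open>simp add: closed_trig_span_def\<close>)

section \<open>The projection onto nonpositive frequencies\<close>

lemma trig_span_closed: "p \<in> trig_span S \<Longrightarrow> p \<in> closed_trig_span S"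
  using trig_span_L2[of p S] by (auto simp: closed_trig_span_def L2_norm_def intro!: bexI[of _ p])

lemma powi_trig_span: "n \<in> S \<Longrightarrow> (\<lambda>z. z powi n) \<in> trig_span S"
  by (auto simp: trig_span_def intro!: exI[of _ "{n}"] exI[of _ "\<lambda>_. 1"])

lemma R_minus_fourier:
  assumes R: "R_minus g h" and n: "n \<le> 0"
  shows "fourier h n = fourier g n"
proof -
  have "g \<in> L2" "h \<in> L2"
    using R by (auto simp: R_minus_def closed_trig_span_def)
  moreover have "fourier (\<lambda>z. g z - h z) n = 0"
    using R n trig_span_closed[OF powi_trig_span[of n "{..0}"]]
    by (simp add: R_minus_def fourier_eq_inner)
  ultimately show ?thesis by (simp add: fourier_diff)
qed

text \<open>
Orthogonality to the characters with frequency in \<open>S\<close> passes to finite combinations by linearity and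
to their limits by Cauchy--Schwarz.
\<close>
lemma L2_inner_closed_trig_span:
  assumes f: "f \<in> L2" and u: "u \<in> closed_trig_span S" and 0: "\<And>n. n \<in> S \<Longrightarrow> fourier f n = 0"
  shows "L2_inner f u = 0"
proof (rule ccontr)
  assume "L2_inner f u \<noteq> 0"
  then have pos: "0 < cmod (L2_inner f u)" by simp
  have uL: "u \<in> L2" using u by (simp add: closed_trig_span_def)
  \<comment> \<open>The summand 1 keeps the denominator positive when \<open>f\<close> vanishes almost everywhere.\<close>
  define e where "e = cmod (L2_inner f u) / (L2_norm f + 1)"
  have "e > 0" using pos L2_norm_nonneg[of f] by (simp add: e_def add_nonneg_pos)
  then obtain p where p: "p \<in> trig_span S" and ce: "L2_norm (\<lambda>z. u z - p z) < e"
    using u unfolding closed_trig_span_def by blast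
  then obtain F c where F: "F \<subseteq> S" and p_def: "p = (\<lambda>z. \<Sum>n\<in>F. c n * z powi n)"
    unfolding trig_span_def by blast
  have pL: "p \<in> L2" by (simp add: p_def L2_trig)
  have "L2_inner f p = 0"
    using F 0 by (auto simp: p_def inner_trig[OF f] intro!: sum.neutral)
  then have "L2_inner f u = L2_inner f (\<lambda>z. u z - p z)"
    using f uL pL by (simp add: L2_inner_def right_diff_distrib integrable_L2_inner)
  then have "cmod (L2_inner f u) \<le> L2_norm f * L2_norm (\<lambda>z. u z - p z)"
    using L2_inner_Cauchy_Schwarz[OF f L2_diff[OF uL pL]] by simp
  also have "\<dots> \<le> L2_norm f * e"
    using ce by (intro mult_left_mono L2_norm_nonneg) simp
  also have "\<dots> < (L2_norm f + 1) * e" using \<open>e > 0\<close> by simp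
  also have "\<dots> = cmod (L2_inner f u)" using L2_norm_nonneg[of f] by (simp add: e_def)
  finally show False by simp
qed

text \<open>
When the coefficients at nonpositive frequencies are absolutely summable, their Fourier series
converges uniformly on the circle. Its sum is then a limit in \<open>L\<^sup>2\<close> of its partial sums and has the
prescribed coefficients, so the difference with \<open>g\<close> is orthogonal to all of the closed span. Thus the
pointwise defined series is a representative of \<open>R\<^sub>-(g)\<close>.
\<close>
lemma R_minus_of_summable:
  assumes g: "g \<in> L2" and h: "h \<in> borel_measurable circle"
    and sm: "summable (\<lambda>k. cmod (fourier g (- int k)))"
    and hz: "\<And>z. norm z = 1 \<Longrightarrow> h z = (\<Sum>k. fourier g (- int k) * z powi (- int k))"
  shows "R_minus g h"
proof -
  define c where "c k = fourier g (- int k)" for k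
  define p where "p N = (\<lambda>z. \<Sum>n\<in>(\<lambda>k. - int k) ` {..<N}. fourier g n * z powi n)" for N
  define r where "r N = (\<Sum>k. cmod (c (k + N)))" for N
  have p_eq: "p N z = (\<Sum>k<N. c k * z powi (- int k))" for N z
    by (simp add: p_def c_def sum.reindex inj_on_def)
  have r0: "r \<longlonglongrightarrow> 0"
    unfolding r_def using sm by (intro suminf_exist_split2) (simp add: c_def)
  have err: "cmod (h z - p N z) \<le> r N" if z: "norm z = 1" for z N
  proof -
    have n: "cmod (c k * z powi (- int k)) = cmod (c k)" for k
      using z by (simp add: norm_mult norm_powi_circle)
    have s: "summable (\<lambda>k. cmod (c k * z powi (- int k)))"
      unfolding n using sm by (simp add: c_def)
    have "h z = (\<Sum>k. c (k + N) * z powi (- int (k + N))) + p N z"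
      unfolding hz[OF z] p_eq c_def[symmetric]
      by (rule suminf_split_initial_segment[OF summable_norm_cancel[OF s]])
    then have "cmod (h z - p N z) = cmod (\<Sum>k. c (k + N) * z powi (- int (k + N)))" by simp
    also have "\<dots> \<le> r N"
      using summable_norm[of "\<lambda>k. c (k + N) * z powi (- int (k + N))"] summable_ignore_initial_segment[OF s, of N]
      by (simp only: n r_def)
    finally show ?thesis .
  qed
  have pT: "p N \<in> trig_span {..0}" for N
    unfolding trig_span_def p_def by (auto intro!: exI[of _ "(\<lambda>k. - int k) ` {..<N}"] exI[of _ "fourier g"])
  note pL = trig_span_L2[OF pT]
  have hL: "h \<in> L2"
    by (rule L2_bounded(1)[OF h, of "r 0"]) (use err[of _ 0] in \<open>simp add: p_def\<close>)
  have err2: "L2_norm (\<lambda>z. h z - p N z) \<le> r N" for N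
    by (rule L2_bounded(2)) (use h pL[of N] err in \<open>auto dest: L2_measurable\<close>)
  have small: "\<exists>N\<ge>M. L2_norm (\<lambda>z. h z - p N z) < e" if e: "e > 0" for e M
  proof -
    have "eventually (\<lambda>N. r N < e \<and> N \<ge> M) sequentially"
      using order_tendstoD(2)[OF r0 e] eventually_ge_at_top[of M] by eventually_elim simp
    then obtain N where "r N < e" "N \<ge> M" by (auto dest: eventually_happens)
    then show ?thesis using err2[of N] by (intro exI[of _ N]) simp
  qed
  have hspan: "h \<in> closed_trig_span {..0}"
    using hL small[of _ 0] pT unfolding closed_trig_span_def by blast
  have "fourier h n = fourier g n" if "n \<le> 0" for n
  proof (rule fourier_approx[OF hL])
    fix e :: real assume "e > 0"
    from small[OF this, of "Suc (nat (- n))"] obtain N where N: "Suc (nat (- n)) \<le> N" "L2_norm (\<lambda>z. h z - p N z) < e"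
      by blast
    have "n \<in> (\<lambda>k. - int k) ` {..<N}"
      using N(1) that by (intro image_eqI[of _ _ "nat (- n)"]) auto
    then have "fourier (p N) n = fourier g n"
      unfolding p_def by (subst fourier_trig) auto
    then show "\<exists>p\<in>L2. L2_norm (\<lambda>z. h z - p z) < e \<and> fourier p n = fourier g n"
      using N pL by blast
  qed
  then have "fourier (\<lambda>z. g z - h z) n = 0" if "n \<in> {..0}" for n
    using that by (simp add: fourier_diff g hL)
  then show ?thesis
    using g hspan L2_inner_closed_trig_span[OF L2_diff[OF g hL], of _ "{..0}"]
    unfolding R_minus_def by blast
qed

section \<open>Trigonometric polynomials and multiplication by the symbol\<close>

lemma trig_span_H2:
  assumes "f \<in> trig_span {0..}"
  shows "f \<in> H2"
proof -
  obtain F c where F: "finite F" "F \<subseteq> {0..}" and f: "f = (\<lambda>z. \<Sum>n\<in>F. c n * z powi n)"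
    using assms by (auto simp: trig_span_def)
  define a where "a n = (if int n \<in> F then c (int n) else 0)" for n
  have fin: "finite {n. int n \<in> F}"
    using finite_vimageI[OF F(1), of int] by (simp add: vimage_def inj_on_def)
  then obtain M where M: "\<And>n. int n \<in> F \<Longrightarrow> n < M"
    by (metis finite_nat_set_iff_bounded mem_Collect_eq)
  have *: "(\<Sum>n<N. a n * z ^ n) = f z" if "M \<le> N" for N z
  proof -
    have "(\<Sum>n<N. a n * z ^ n) = (\<Sum>m\<in>int ` {..<N}. (if m \<in> F then c m else 0) * z powi m)"
      by (simp add: sum.reindex a_def)
    also have "\<dots> = (\<Sum>m\<in>F. (if m \<in> F then c m else 0) * z powi m)"
    proof (rule sum.mono_neutral_right)
      show "F \<subseteq> int ` {..<N}"
      proof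
        fix m assume "m \<in> F"
        then have "m \<ge> 0" "nat m < M" using F(2) M[of "nat m"] by auto
        then show "m \<in> int ` {..<N}" using that by (intro image_eqI[of _ _ "nat m"]) auto
      qed
    qed auto
    finally show ?thesis by (simp add: f)
  qed
  have "summable (\<lambda>n. (cmod (a n))\<^sup>2)"
    by (rule summable_finite[OF fin]) (auto simp: a_def)
  moreover have "eventually (\<lambda>N. L2_norm (\<lambda>z. f z - (\<Sum>n<N. a n * z ^ n)) = 0) sequentially"
    using eventually_ge_at_top[of M] by eventually_elim (simp add: * L2_norm_def)
  ultimately show ?thesis
    using trig_span_L2[OF assms] by (auto simp: H2_def intro!: exI[of _ a] tendsto_eventually)
qed

lemma fourier_mult_trig:
  assumes "\<phi> \<in> L2"
  shows "fourier (\<lambda>z. \<phi> z * (\<Sum>n\<in>F. c n * z powi n)) m = (\<Sum>n\<in>F. c n * fourier \<phi> (m - n))"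
proof -
  have *: "(\<lambda>z. \<phi> z * z powi n) \<in> L2" for n
    by (rule L2_mult_bounded[OF assms, of _ 1]) (auto simp: norm_powi_circle)
  have "(\<lambda>z. \<phi> z * (\<Sum>n\<in>F. c n * z powi n)) = (\<lambda>z. \<Sum>n\<in>F. c n * (\<phi> z * z powi n))"
    by (simp add: sum_distrib_left ac_simps)
  then show ?thesis
    by (simp add: fourier_sum L2_cmult * fourier_cmult fourier_mult_powi)
qed

lemma L2_mult_trig:
  assumes "\<phi> \<in> L2" "p \<in> trig_span S"
  shows "(\<lambda>z. \<phi> z * p z) \<in> L2"
proof -
  obtain F c where p: "p = (\<lambda>z. \<Sum>n\<in>F. c n * z powi n)"
    using assms(2) by (auto simp: trig_span_def)
  show ?thesis
  proof (rule L2_mult_bounded[OF assms(1)])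
    show "cmod (p z) \<le> (\<Sum>n\<in>F. cmod (c n))" if "norm z = 1" for z
      using that by (auto simp: p norm_mult norm_powi_circle intro!: sum_norm_le)
  qed (use assms trig_span_L2 L2_measurable in blast)
qed

section \<open>Bounded functions with nonnegative Fourier coefficients\<close>

text \<open>
The weight \<open>\<bar>1 + z + \<dots> + z\<^sup>M\<^sup>-\<^sup>1\<bar>\<^sup>2\<close> is \<open>M\<close> times the Fejer kernel: it is nonnegative, and expanding
the square expresses the weighted mean of \<open>h\<close> through Fourier coefficients only.
\<close>
lemma integral_Fejer:
  fixes M :: nat
  assumes h: "h \<in> L2"
  shows "(LINT z|circle. h z * of_real ((cmod (\<Sum>j<M. z ^ j))\<^sup>2)) = (\<Sum>i<M. \<Sum>j<M. fourier h (int j - int i))"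
proof -
  have "(LINT z|circle. h z * of_real ((cmod (\<Sum>j<M. z ^ j))\<^sup>2)) =
    (LINT z|circle. (\<Sum>i<M. \<Sum>j<M. h z * z powi (int i - int j)))"
  proof (rule integral_circle_cong)
    fix z :: complex assume z: "norm z = 1"
    have "z ^ i * cnj (z ^ j) = z powi (int i - int j)" for i j
      using z cnj_powi_circle[OF z, of "int j"]
      by (subst diff_conv_add_uminus, subst power_int_add) auto
    then show "h z * of_real ((cmod (\<Sum>j<M. z ^ j))\<^sup>2) = (\<Sum>i<M. \<Sum>j<M. h z * z powi (int i - int j))"
      unfolding complex_norm_square cnj_sum sum_product by (simp only: sum_distrib_left)
  qed
  also have "\<dots> = (\<Sum>i<M. \<Sum>j<M. fourier h (int j - int i))"
    using h by (simp add: integrable_fourier fourier_def)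
  finally show ?thesis .
qed

text \<open>
For \<open>M = K + L\<close> the Fejer weight \<open>D\<close> has total mass \<open>M\<close>, so the weighted integral of \<open>h\<close> is at most
\<open>B M\<close>. It also equals \<open>P\<^sub>1 + \<dots> + P\<^sub>M\<close>, where \<open>P\<^sub>i\<close> denotes the sum of the first \<open>i\<close> numbers \<open>c k\<close>. As
the \<open>c k\<close> are nonnegative, at least \<open>L\<close> of these partial sums are no smaller than \<open>P\<^sub>K\<close>. Hence
\<open>L P\<^sub>K \<le> B (K + L)\<close>, and letting \<open>L\<close> grow gives the claim with the sharp constant.
\<close>
lemma nonneg_fourier_sum_le_bound:
  assumes h: "h \<in> L2" and B: "AE z in circle. cmod (h z) \<le> B"
    and pos: "\<And>m. m > 0 \<Longrightarrow> fourier h m = 0"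
    and neg: "\<And>k. fourier h (- int k) = of_real (c k)"
    and c: "\<And>k. 0 \<le> c k"
  shows "(\<Sum>k<K. c k) \<le> B"
proof (rule ccontr)
  define P where "P = (\<Sum>k<K. c k)"
  have main: "real L * P \<le> B * (real L + real K)" for L
  proof -
    define M where "M = K + L"
    define D where "D = (\<lambda>z::complex. (cmod (\<Sum>j<M. z ^ j))\<^sup>2)"
    have Dm: "D \<in> borel_measurable circle"
      unfolding D_def by (intro borel_measurable_circleI continuous_intros)
    have Db: "cmod (of_real (D z)) \<le> (real M)\<^sup>2" if "norm z = 1" for z
    proof -
      have "cmod (\<Sum>j<M. z ^ j) \<le> (\<Sum>j<M. 1)"
        by (rule sum_norm_le) (simp add: norm_power that)
      then show ?thesis by (simp add: D_def power_mono norm_power)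
    qed
    have DL: "(\<lambda>z. complex_of_real (D z)) \<in> L2"
      by (rule L2_bounded(1)[OF _ Db]) (use Dm in auto)
    have one: "(\<lambda>_. 1) \<in> L2" by (rule L2_bounded(1)[of _ 1]) auto
    have Di: "integrable circle D"
      by (rule circle.integrable_const_bound[OF AE_circleI Dm]) (use Db in \<open>simp only: norm_of_real real_norm_def\<close>)
    have "complex_of_real (LINT z|circle. D z) = (LINT z|circle. 1 * of_real (D z))"
      by simp
    also have "\<dots> = (\<Sum>i<M. \<Sum>j<M. fourier (\<lambda>z. z powi 0) (int j - int i))"
      unfolding D_def using integral_Fejer[OF one, of M] by simp
    also have "\<dots> = of_nat M"
      unfolding fourier_powi by (simp add: of_bool_def)
    finally have DM: "(LINT z|circle. D z) = real M"
      by (metis of_real_eq_iff of_real_of_nat_eq)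
    have "real L * P = (\<Sum>i\<in>{K..<M}. P)" by (simp add: M_def)
    also have "\<dots> \<le> (\<Sum>i\<in>{K..<M}. \<Sum>j\<le>i. c (i - j))"
    proof (rule sum_mono)
      fix i assume i: "i \<in> {K..<M}"
      have "(\<Sum>j\<le>i. c (i - j)) = (\<Sum>k\<le>i. c k)"
        by (rule sum.nat_diff_reindex[of c "Suc i", simplified lessThan_Suc_atMost, simplified])
      moreover have "P \<le> (\<Sum>k\<le>i. c k)"
        unfolding P_def using i c by (intro sum_mono2) auto
      ultimately show "P \<le> (\<Sum>j\<le>i. c (i - j))" by simp
    qed
    also have "\<dots> \<le> (\<Sum>i<M. \<Sum>j\<le>i. c (i - j))"
      using c by (intro sum_mono2 sum_nonneg) auto
    also have "\<dots> = cmod (\<Sum>i<M. \<Sum>j<M. fourier h (int j - int i))"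
    proof -
      have "(\<Sum>j<M. fourier h (int j - int i)) = of_real (\<Sum>j\<le>i. c (i - j))" if "i < M" for i
      proof -
        have "(\<Sum>j<M. fourier h (int j - int i)) = (\<Sum>j\<le>i. fourier h (int j - int i))"
          \<comment> \<open>Only \<open>j \<le> i\<close> contributes, since \<open>h\<close> has no positive frequencies.\<close>
          by (rule sum.mono_neutral_right) (use that pos in auto)
        also have "\<dots> = (\<Sum>j\<le>i. of_real (c (i - j)))"
        proof (rule sum.cong[OF refl])
          fix j assume "j \<in> {..i}"
          then show "fourier h (int j - int i) = of_real (c (i - j))"
            using neg[of "i - j"] by (simp add: of_nat_diff)
        qed
        finally show ?thesis by simp
      qed
      then have "(\<Sum>i<M. \<Sum>j<M. fourier h (int j - int i)) = of_real (\<Sum>i<M. \<Sum>j\<le>i. c (i - j))"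
        by simp
      moreover have "0 \<le> (\<Sum>i<M. \<Sum>j\<le>i. c (i - j))" by (intro sum_nonneg c)
      ultimately show ?thesis by (simp only: norm_of_real abs_of_nonneg)
    qed
    also have "\<dots> = cmod (LINT z|circle. h z * of_real (D z))"
      unfolding D_def integral_Fejer[OF h] ..
    also have "\<dots> \<le> (LINT z|circle. cmod (h z * of_real (D z)))"
      by (rule integral_norm_bound)
    also have "\<dots> \<le> (LINT z|circle. B * D z)"
    proof (rule integral_mono_AE)
      show "integrable circle (\<lambda>z. cmod (h z * complex_of_real (D z)))"
        using integrable_L2_inner[OF h DL] by (intro integrable_norm) simp
      show "AE z in circle. cmod (h z * complex_of_real (D z)) \<le> B * D z"
        using B
      proof eventually_elim
        case (elim z)
        have "0 \<le> D z" by (simp add: D_def)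
        then show ?case using elim by (simp only: norm_mult norm_of_real abs_of_nonneg mult_right_mono)
      qed
    qed (use Di in simp)
    also have "\<dots> = B * (real L + real K)"
      by (simp add: DM) (simp add: M_def)
    finally show ?thesis .
  qed
  assume "\<not> (\<Sum>k<K. c k) \<le> B"
  then have "0 < P - B" by (simp add: P_def)
  then obtain L where "B * real K < real L * (P - B)"
    using reals_Archimedean3 by blast
  with main[of L] show False by (simp add: algebra_simps)
qed

section \<open>The operator given by the Hankel matrix\<close>

lemma suminf_Cauchy_Schwarz:
  fixes x y :: "nat \<Rightarrow> real"
  assumes x: "\<And>n. 0 \<le> x n" "summable (\<lambda>n. (x n)\<^sup>2)" and y: "\<And>n. 0 \<le> y n" "summable (\<lambda>n. (y n)\<^sup>2)"
  shows "summable (\<lambda>n. x n * y n)" "(\<Sum>n. x n * y n) \<le> sqrt (\<Sum>n. (x n)\<^sup>2) * sqrt (\<Sum>n. (y n)\<^sup>2)"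
proof -
  have le: "(\<Sum>n<N. x n * y n) \<le> sqrt (\<Sum>n. (x n)\<^sup>2) * sqrt (\<Sum>n. (y n)\<^sup>2)" for N
  proof -
    have "(\<Sum>n<N. x n * y n)\<^sup>2 \<le> (\<Sum>n<N. (x n)\<^sup>2) * (\<Sum>n<N. (y n)\<^sup>2)"
      by (rule Cauchy_Schwarz_ineq_sum)
    also have "\<dots> \<le> (\<Sum>n. (x n)\<^sup>2) * (\<Sum>n. (y n)\<^sup>2)"
      using x y by (intro mult_mono sum_le_suminf sum_nonneg suminf_nonneg) auto
    finally show ?thesis
      by (metis real_le_rsqrt real_sqrt_mult)
  qed
  show s: "summable (\<lambda>n. x n * y n)"
    using x y by (intro summableI_nonneg_bounded[OF _ le]) simp
  show "(\<Sum>n. x n * y n) \<le> sqrt (\<Sum>n. (x n)\<^sup>2) * sqrt (\<Sum>n. (y n)\<^sup>2)"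
    by (rule suminf_le_const[OF s le])
qed

definition tail :: "(nat \<Rightarrow> real) \<Rightarrow> nat \<Rightarrow> real" where
  "tail b n = (\<Sum>k. b (n + k))"

text \<open>
The value of the Hankel operator at \<open>z\<^sup>n\<close>, when \<open>b k\<close> is the Fourier coefficient of the symbol at \<open>-k\<close>.
\<close>
definition monomial_image :: "(nat \<Rightarrow> real) \<Rightarrow> nat \<Rightarrow> complex \<Rightarrow> complex" where
  "monomial_image b n z = (\<Sum>k. of_real (b (n + k)) * z powi (- int k))"

text \<open>
The Hankel operator extended from monomials by linearity. It reads only the Fourier coefficients of
its argument, and therefore does not distinguish functions that agree almost everywhere.
\<close>
definition hankel_series :: "(nat \<Rightarrow> real) \<Rightarrow> (complex \<Rightarrow> complex) \<Rightarrow> (complex \<Rightarrow> complex)" where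
  "hankel_series b f z = (\<Sum>n. fourier f (int n) * monomial_image b n z)"

lemma
  fixes b :: "nat \<Rightarrow> real"
  assumes b: "\<And>k. 0 \<le> b k" and sb: "summable b" and z: "norm z = 1"
  shows norm_monomial_image_le: "cmod (monomial_image b n z) \<le> tail b n"
    and summable_monomial_image: "summable (\<lambda>k. complex_of_real (b (n + k)) * z powi (- int k))"
proof -
  have n: "cmod (complex_of_real (b (n + k)) * z powi (- int k)) = b (n + k)" for k
    using z b by (simp add: norm_mult norm_powi_circle)
  have s: "summable (\<lambda>k. b (n + k))"
    using summable_ignore_initial_segment[OF sb, of n] by (simp add: add.commute)
  show "summable (\<lambda>k. complex_of_real (b (n + k)) * z powi (- int k))"
    by (rule summable_norm_cancel) (use s in \<open>simp only: n\<close>)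
  show "cmod (monomial_image b n z) \<le> tail b n"
    using summable_norm[of "\<lambda>k. complex_of_real (b (n + k)) * z powi (- int k)"] s
    by (simp only: n monomial_image_def tail_def)
qed

lemma tail_nonneg: "(\<And>k. 0 \<le> b k) \<Longrightarrow> summable b \<Longrightarrow> 0 \<le> tail b n"
  using norm_monomial_image_le[of b 1 n] order_trans[OF norm_ge_zero] by fastforce

text \<open>
On the circle the \<open>n\<close>-th monomial image is at most \<open>tail b n\<close>, so the series is dominated by the
pairing of the square-summable sequences \<open>\<bar>fourier f n\<bar>\<close> and \<open>tail b n\<close>; Cauchy--Schwarz bounds it
uniformly in \<open>z\<close>.
\<close>
lemma
  fixes b :: "nat \<Rightarrow> real"
  assumes b: "\<And>k. 0 \<le> b k" and sb: "summable b" and st: "summable (\<lambda>n. (tail b n)\<^sup>2)"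
    and f: "f \<in> L2" and z: "norm z = 1"
  shows summable_hankel_series: "summable (\<lambda>n. fourier f (int n) * monomial_image b n z)"
    and norm_hankel_series_le: "cmod (hankel_series b f z) \<le> sqrt (\<Sum>n. (tail b n)\<^sup>2) * H2_norm f"
proof -
  have le: "cmod (fourier f (int n) * monomial_image b n z) \<le> cmod (fourier f (int n)) * tail b n" for n
    by (simp add: norm_mult mult_left_mono norm_monomial_image_le[OF b sb z])
  note CS = suminf_Cauchy_Schwarz[OF _ summable_fourier_sq[OF f] tail_nonneg[OF b sb] st]
  have s: "summable (\<lambda>n. cmod (fourier f (int n) * monomial_image b n z))"
    by (rule summable_comparison_test'[OF CS(1), of 0]) (use le in auto)
  then show "summable (\<lambda>n. fourier f (int n) * monomial_image b n z)"
    by (rule summable_norm_cancel)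
  have "cmod (hankel_series b f z) \<le> (\<Sum>n. cmod (fourier f (int n) * monomial_image b n z))"
    unfolding hankel_series_def by (rule summable_norm[OF s])
  also have "\<dots> \<le> (\<Sum>n. cmod (fourier f (int n)) * tail b n)"
    by (rule suminf_le[OF le s CS(1)]) simp
  also have "\<dots> \<le> H2_norm f * sqrt (\<Sum>n. (tail b n)\<^sup>2)"
    unfolding H2_norm_def by (rule CS(2)) simp
  finally show "cmod (hankel_series b f z) \<le> sqrt (\<Sum>n. (tail b n)\<^sup>2) * H2_norm f"
    by (simp add: mult.commute)
qed

lemma measurable_hankel_series: "hankel_series b f \<in> borel_measurable circle"
  unfolding hankel_series_def[abs_def] monomial_image_def[abs_def] by measurable

text \<open>
The witness is the operator \<open>hankel_series b\<close>. The pointwise bound above makes it bounded into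
\<open>L\<^sup>\<infinity>\<close>. On a polynomial it is a finite combination of monomial images, that is, an absolutely
convergent Fourier series whose coefficients are those of the product with the symbol, so it agrees
with \<open>R\<^sub>-\<close> there.
\<close>
lemma tail_summable_imp_hankel_bounded:
  fixes b :: "nat \<Rightarrow> real"
  assumes \<phi>: "\<phi> \<in> L2" and four: "\<And>k. fourier \<phi> (- int k) = of_real (b k)" and b: "\<And>k. 0 \<le> b k"
    and sb: "summable b" and st: "summable (\<lambda>n. (tail b n)\<^sup>2)"
  shows "hankel_bounded_H2_Linf \<phi>"
  unfolding hankel_bounded_H2_Linf_def
proof (intro exI conjI ballI)
  note sums = summable_hankel_series[OF b sb st H2_L2]
  define C where "C = sqrt (\<Sum>n. (tail b n)\<^sup>2)"
  have le: "Linf_norm (hankel_series b f) \<le> ereal (C * H2_norm f)" if "f \<in> H2" for f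
    unfolding Linf_norm_def C_def
    by (rule esssup_I) (use measurable_hankel_series norm_hankel_series_le[OF b sb st H2_L2[OF that]]
      in \<open>auto intro!: AE_circleI\<close>)
  show "bounded_operator_H2_Linf (hankel_series b)"
    unfolding bounded_operator_H2_Linf_def
  proof (intro conjI ballI allI impI)
    fix f assume f: "f \<in> H2"
    show "hankel_series b f \<in> Linf"
      using order_le_less_trans[OF le[OF f], of \<infinity>] measurable_hankel_series by (simp add: Linf_def)
    show "AE z in circle. hankel_series b (\<lambda>w. c * f w) z = c * hankel_series b f z" for c
      by (rule AE_circleI)
        (simp add: hankel_series_def fourier_cmult mult.assoc suminf_mult sums[OF f])
    fix g assume g: "g \<in> H2"
    show "AE z in circle. hankel_series b f z = hankel_series b g z" if "AE z in circle. f z = g z"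
      using fourier_cong_AE[OF H2_L2[OF f] H2_L2[OF g] that] by (simp add: hankel_series_def)
    show "AE z in circle. hankel_series b (\<lambda>w. f w + g w) z = hankel_series b f z + hankel_series b g z"
      by (rule AE_circleI)
        (simp add: hankel_series_def fourier_add H2_L2 f g distrib_right suminf_add sums[OF f] sums[OF g])
  next
    show "\<exists>C. \<forall>f\<in>H2. Linf_norm (hankel_series b f) \<le> ereal (C * H2_norm f)"
      using le by blast
  qed
  fix f assume fT: "f \<in> trig_span {0..}"
  then obtain F' c where F': "finite F'" "F' \<subseteq> {0..}" and "f = (\<lambda>z. \<Sum>n\<in>F'. c n * z powi n)"
    by (auto simp: trig_span_def)
  moreover obtain F where F: "F' = int ` F" 
    using F'(2) by (metis nonneg_int_cases atLeast_iff subset_imageE rangeI subsetI subset_iff)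
  moreover have "finite F" using F' F by (simp add: finite_image_iff)
  ultimately have finF: "finite F" and f: "f = (\<lambda>z. \<Sum>n\<in>int ` F. c n * z powi n)" by auto
  have four_f: "fourier f (int n) = (if n \<in> F then c (int n) else 0)" for n
    unfolding f by (subst fourier_trig) (use finF in auto)
  have coef: "fourier (\<lambda>z. \<phi> z * f z) (- int k) = (\<Sum>n\<in>F. c (int n) * of_real (b (n + k)))" for k
  proof -
    have "fourier (\<lambda>z. \<phi> z * f z) (- int k) = (\<Sum>n\<in>F. c (int n) * fourier \<phi> (- int (n + k)))"
      unfolding f fourier_mult_trig[OF \<phi>] by (simp add: sum.reindex minus_diff_commute)
    then show ?thesis by (simp only: four)
  qed
  show "R_minus (\<lambda>z. \<phi> z * f z) (hankel_series b f)"
  proof (rule R_minus_of_summable[OF L2_mult_trig[OF \<phi> fT] measurable_hankel_series])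
    have "summable (\<lambda>k. \<Sum>n\<in>F. cmod (c (int n)) * b (n + k))"
      using summable_ignore_initial_segment[OF sb]
      by (intro summable_sum summable_mult) (simp add: add.commute)
    then show "summable (\<lambda>k. cmod (fourier (\<lambda>z. \<phi> z * f z) (- int k)))"
      by (rule summable_comparison_test'[of _ 0])
         (auto simp: coef norm_mult b intro!: sum_norm_le)
    fix z :: complex assume z: "norm z = 1"
    have "hankel_series b f z = (\<Sum>n\<in>F. c (int n) * monomial_image b n z)"
      unfolding hankel_series_def by (subst suminf_finite[OF finF]) (auto simp: four_f)
    also have "\<dots> = (\<Sum>n\<in>F. \<Sum>k. c (int n) * (of_real (b (n + k)) * z powi (- int k)))"
      unfolding monomial_image_def
      by (simp add: suminf_mult summable_monomial_image[OF b sb z])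
    also have "\<dots> = (\<Sum>k. \<Sum>n\<in>F. c (int n) * (of_real (b (n + k)) * z powi (- int k)))"
      by (rule suminf_sum[symmetric]) (intro summable_mult summable_monomial_image[OF b sb z])
    also have "\<dots> = (\<Sum>k. fourier (\<lambda>z. \<phi> z * f z) (- int k) * z powi (- int k))"
      by (simp add: coef sum_distrib_right mult.assoc)
    finally show "hankel_series b f z = (\<Sum>k. fourier (\<lambda>z. \<phi> z * f z) (- int k) * z powi (- int k))" .
  qed
qed

section \<open>The criterion\<close>

text \<open>
The operator is tested on \<open>f = \<Sum>\<^bsub>n<N\<^esub> a n z\<^sup>n\<close> with the nonnegative weights \<open>a n\<close> equal to truncated
tails. This is the choice for which Cauchy--Schwarz against the tails is an equality: the sum of the
first \<open>K\<close> coefficients of the image is exactly \<open>A = \<Sum>\<^bsub>n<N\<^esub> (a n)\<^sup>2\<close>. These coefficients are nonnegative,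
so the sum is at most the supremum norm of the image, which gives \<open>A \<le> C A\<^sup>1\<^sup>/\<^sup>2\<close>, hence \<open>A \<le> C\<^sup>2\<close>
uniformly in \<open>N\<close> and \<open>K\<close>. Truncation keeps everything finite before the summability of \<open>b\<close> is known;
it is removed by letting \<open>K\<close> and then \<open>N\<close> tend to infinity.
\<close>
lemma hankel_bounded_imp_tail_summable:
  fixes b :: "nat \<Rightarrow> real"
  assumes \<phi>: "\<phi> \<in> L2" and four: "\<And>k. fourier \<phi> (- int k) = of_real (b k)" and b: "\<And>k. 0 \<le> b k"
    and bdd: "hankel_bounded_H2_Linf \<phi>"
  shows "summable b \<and> summable (\<lambda>n. (tail b n)\<^sup>2)"
proof -
  obtain T where T: "bounded_operator_H2_Linf T"
    and TR: "\<forall>f\<in>trig_span {0..}. R_minus (\<lambda>z. \<phi> z * f z) (T f)"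
    using bdd unfolding hankel_bounded_H2_Linf_def by (elim exE conjE)
  obtain C where TC: "\<forall>f\<in>H2. Linf_norm (T f) \<le> ereal (C * H2_norm f)"
    using T unfolding bounded_operator_H2_Linf_def by (elim exE conjE)
  have key: "(\<Sum>n<N. (\<Sum>k<K. b (n + k))\<^sup>2) \<le> C\<^sup>2" for N K
  proof -
    define a where "a n = (\<Sum>k<K. b (n + k))" for n
    define A where "A = (\<Sum>n<N. (a n)\<^sup>2)"
    define f where "f = (\<lambda>z. \<Sum>n\<in>int ` {..<N}. complex_of_real (a (nat n)) * z powi n)"
    define c where "c k = (\<Sum>n<N. a n * b (n + k))" for k
    have a0: "0 \<le> a n" for n by (simp add: a_def b sum_nonneg)
    have A0: "0 \<le> A" by (simp add: A_def sum_nonneg)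
    have fT: "f \<in> trig_span {0..}"
      unfolding trig_span_def f_def
      by (auto intro!: exI[of _ "int ` {..<N}"] exI[of _ "\<lambda>n. complex_of_real (a (nat n))"])
    note fH = trig_span_H2[OF fT]
    have "fourier f (int n) = (if n < N then of_real (a n) else 0)" for n
      unfolding f_def by (subst fourier_trig) auto
    then have "(\<Sum>n. (cmod (fourier f (int n)))\<^sup>2) = (\<Sum>n<N. (a n)\<^sup>2)"
      by (subst suminf_finite[of "{..<N}"]) auto
    then have fn: "H2_norm f = sqrt A" by (simp add: H2_norm_def A_def)
    note R = bspec[OF TR fT]
    have hS: "T f \<in> closed_trig_span {..0}" using R by (simp add: R_minus_def)
    then have hL: "T f \<in> L2" by (simp add: closed_trig_span_def)
    have "AE z in circle. ereal (cmod (T f z)) \<le> Linf_norm (T f)"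
      unfolding Linf_norm_def by (rule esssup_AE)
    then have hB: "AE z in circle. cmod (T f z) \<le> C * sqrt A"
    proof eventually_elim
      case (elim z)
      then have "ereal (cmod (T f z)) \<le> ereal (C * sqrt A)"
        using bspec[OF TC fH] unfolding fn by (rule order_trans)
      then show ?case by simp
    qed
    have hc: "fourier (T f) (- int k) = of_real (c k)" for k
    proof -
      have "fourier (T f) (- int k) = fourier (\<lambda>z. \<phi> z * f z) (- int k)"
        by (rule R_minus_fourier[OF R]) simp
      also have "\<dots> = (\<Sum>n<N. of_real (a n) * fourier \<phi> (- int k - int n))"
        unfolding f_def fourier_mult_trig[OF \<phi>] by (simp add: sum.reindex)
      also have "\<dots> = of_real (c k)"
      proof -
        have "- int k - int n = - int (n + k)" for n by simp
        then show ?thesis by (simp only: four c_def of_real_sum of_real_mult)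
      qed
      finally show ?thesis .
    qed
    have "(a n)\<^sup>2 = (\<Sum>k<K. a n * b (n + k))" for n
      unfolding sum_distrib_left[symmetric] a_def power2_eq_square ..
    then have "A = (\<Sum>n<N. \<Sum>k<K. a n * b (n + k))"
      by (simp only: A_def)
    also have "\<dots> = (\<Sum>k<K. c k)"
      unfolding c_def by (rule sum.swap)
    also have "\<dots> \<le> C * sqrt A"
      by (rule nonneg_fourier_sum_le_bound[OF hL hB fourier_closed_trig_span[OF hS] hc])
         (auto simp: c_def a0 b intro!: sum_nonneg)
    finally have "A \<le> C * sqrt A" .
    then have "A\<^sup>2 \<le> C\<^sup>2 * A"
      using power_mono[OF _ A0, of "C * sqrt A" 2] A0 by (simp add: power_mult_distrib)
    then have "A \<le> C\<^sup>2" using A0 by (cases "A = 0") (auto simp: power2_eq_square)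
    then show ?thesis by (simp add: A_def a_def)
  qed
  \<comment> \<open>The case \<open>N = 1\<close> bounds the partial sums of \<open>b\<close> itself.\<close>
  have sb: "summable b"
  proof (rule summableI_nonneg_bounded[OF b])
    fix K
    \<comment> \<open>The constant \<open>C\<close> may be negative, which is why its absolute value serves as the bound.\<close>
    have "(\<Sum>k<K. b k)\<^sup>2 \<le> \<bar>C\<bar>\<^sup>2" using key[where N = 1 and K = K] by simp
    then show "(\<Sum>k<K. b k) \<le> \<bar>C\<bar>" by (rule power2_le_imp_le) simp
  qed
  have "(\<lambda>K. \<Sum>k<K. b (n + k)) \<longlonglongrightarrow> tail b n" for n
    unfolding tail_def using summable_ignore_initial_segment[OF sb, of n]
    by (intro summable_LIMSEQ) (simp add: add.commute)
  then have "(\<Sum>n<N. (tail b n)\<^sup>2) \<le> C\<^sup>2" for N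
    using key by (intro LIMSEQ_le_const2[of "\<lambda>K. \<Sum>n<N. (\<Sum>k<K. b (n + k))\<^sup>2"]) (auto intro!: tendsto_intros)
  then have "summable (\<lambda>n. (tail b n)\<^sup>2)"
    by (intro summableI_nonneg_bounded[where x = "C\<^sup>2"]) simp_all
  with sb show ?thesis ..
qed

text \<open>
In the extended sum an infinite tail makes its square infinite, so finiteness of the term \<open>n = 0\<close>
already contains the summability of \<open>b\<close>; after that both sides are sums of the same real numbers.
\<close>
lemma ennreal_tail_sum_finite_iff:
  fixes b :: "nat \<Rightarrow> real"
  assumes b: "\<And>k. 0 \<le> b k"
  shows "(\<Sum>n. (\<Sum>k. ennreal (b (n + k)))\<^sup>2) < \<infinity> \<longleftrightarrow> summable b \<and> summable (\<lambda>n. (tail b n)\<^sup>2)"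
proof -
  have eq: "(\<Sum>n. (\<Sum>k. ennreal (b (n + k)))\<^sup>2) = (\<Sum>n. ennreal ((tail b n)\<^sup>2))" if sb: "summable b"
  proof -
    have "(\<Sum>k. ennreal (b (n + k))) = ennreal (tail b n)" for n
      unfolding tail_def using b summable_ignore_initial_segment[OF sb, of n]
      by (intro suminf_ennreal2) (auto simp: add.commute)
    then show ?thesis by (simp add: ennreal_power tail_nonneg[OF b sb])
  qed
  show ?thesis
  proof
    assume fin: "(\<Sum>n. (\<Sum>k. ennreal (b (n + k)))\<^sup>2) < \<infinity>"
    have "(\<Sum>n<1. (\<Sum>k. ennreal (b (n + k)))\<^sup>2) \<le> (\<Sum>n. (\<Sum>k. ennreal (b (n + k)))\<^sup>2)"
      by (intro sum_le_suminf) auto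
    with fin have "(\<Sum>k. ennreal (b k))\<^sup>2 < \<infinity>" by simp
    then have "(\<Sum>k. ennreal (b k)) \<noteq> top" by (simp add: power_less_top_ennreal less_top)
    then have sb: "summable b" by (rule summable_suminf_not_top[OF b])
    moreover have "summable (\<lambda>n. (tail b n)\<^sup>2)"
      using fin unfolding eq[OF sb] by (intro summable_suminf_not_top) auto
    ultimately show "summable b \<and> summable (\<lambda>n. (tail b n)\<^sup>2)" ..
  next
    assume "summable b \<and> summable (\<lambda>n. (tail b n)\<^sup>2)"
    then show "(\<Sum>n. (\<Sum>k. ennreal (b (n + k)))\<^sup>2) < \<infinity>"
      by (simp add: eq suminf_ennreal2)
  qed
qed

lemma infsum_atMost_int:
  fixes g :: "int \<Rightarrow> ennreal"
  shows "(\<Sum>\<^sub>\<infinity>m\<in>{..- int n}. g m) = (\<Sum>k. g (- int (n + k)))"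
proof -
  have "(\<Sum>\<^sub>\<infinity>m\<in>{..- int n}. g m) = (\<Sum>\<^sub>\<infinity>k\<in>UNIV. g (- int (n + k)))"
    by (rule infsum_reindex_bij_witness[of _ "\<lambda>k. - int (n + k)" "\<lambda>m. nat (- m) - n"]) auto
  also have "\<dots> = (\<Sum>k. g (- int (n + k)))"
    by (intro sums_unique has_sum_imp_sums has_sum_infsum nonneg_summable_on_complete) auto
  finally show ?thesis .
qed

theorem proposition1p16:
  fixes \<phi> :: "complex \<Rightarrow> complex"
  assumes "\<phi> \<in> L2"
    and "\<forall>m\<le>0. fourier \<phi> m \<in> \<real>\<^sub>\<ge>\<^sub>0"
  shows "hankel_bounded_H2_Linf \<phi> \<longleftrightarrow>
    (\<Sum>n. (\<Sum>\<^sub>\<infinity>m\<in>{..- int n}. ennreal (Re (fourier \<phi> m)))\<^sup>2) < \<infinity>"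
proof -
  define b where "b k = Re (fourier \<phi> (- int k))" for k
  have nn: "fourier \<phi> (- int k) \<in> \<real>\<^sub>\<ge>\<^sub>0" for k using assms(2) by simp
  have b: "0 \<le> b k" for k using nn[of k] by (simp add: b_def complex_nonneg_Reals_iff)
  have four: "fourier \<phi> (- int k) = of_real (b k)" for k
    using nn[of k] by (simp add: b_def complex_nonneg_Reals_iff complex_eq_iff)
  have "(\<Sum>n. (\<Sum>\<^sub>\<infinity>m\<in>{..- int n}. ennreal (Re (fourier \<phi> m)))\<^sup>2) < \<infinity> \<longleftrightarrow>
      summable b \<and> summable (\<lambda>n. (tail b n)\<^sup>2)"
    unfolding infsum_atMost_int b_def[symmetric] by (rule ennreal_tail_sum_finite_iff[OF b])
  then show ?thesis
    using hankel_bounded_imp_tail_summable[OF assms(1) four b]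
      tail_summable_imp_hankel_bounded[OF assms(1) four b]
    by blast
qed

end
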